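(* Let $\mathcal H$ be the Hopf algebra of a minors system $\mathcal S$ with a combinatorial duality $*$, and let $\delta_{\mathbf a}=\sum_{i\in I}a_i\delta_i$ and $\delta_{\mathbf b}=\sum_{i\in I}b_i\delta_i$ be selectors for $\mathcal H$. Define $\delta_{\mathbf a^*}=\delta_{\mathbf a}\circ *$ and $\delta_{\mathbf b^*}=\delta_{\mathbf b}\circ *$. Then for all $S\in\mathcal H$, $$\alpha(\mathbf a,\mathbf b)(S)=\alpha(\mathbf b^*,\mathbf a^* )(S^* ),$$ where $\alpha(\mathbf a,\mathbf b)=\exp_*(\delta_{\mathbf a})*\exp_*(\delta_{\mathbf b})$ and $\alpha(\mathbf b^*,\mathbf a^* )=\exp_*(\delta_{\mathbf b^*})*\exp_*(\delta_{\mathbf a^*})$.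
   Context: A minors system: graded set $\mathcal S=\bigcup_{n\ge0}\mathcal S_n$, each $S\in\mathcal S_n$ with a set $E(S)$ of $n$ elements, unique $1\in\mathcal S_0$, operations $S\backslash\!\backslash e$, $S/\!/e$ with $E(S\backslash\!\backslash e)=E(S/\!/e)=E(S)\setminus\{e\}$, operations on distinct elements commuting. Its Hopf algebra $\mathcal H$ is the free module with basis $\mathcal S$ (over a field of characteristic 0), graded by $|E(S)|$, with coproduct $\Delta(S)=\sum_{A\subseteq E(S)}(S\backslash\!\backslash A^c)\otimes(S/\!/A)$, counit $1$ on $\mathcal S_0$ and $0$ otherwise, and a multiplication with unit $1$, additive on $E$, compatible with the minor operations. A combinatorial duality is an involutive, grading preserving algebra morphism $*:\mathcal H\to\mathcal H$, $S\mapsto S^*$, such that for all $S\in\mathcal S$ and $e\in E(S)$, $(S\backslash\!\backslash e)^*=S^*/\!/e$ and $(S/\!/e)^*=S^*\backslash\!\backslash e$. With $\{S_i\}_{i\in I}=\mathcal S_1$, $\delta_i$ is the linear map with $\delta_i(S_i)=1$ and $0$ on other elements of $\mathcal S$. $f*g=m\circ(f\otimes g)\circ\Delta$, $\exp_*(\delta)=\sum_{k\ge0}\delta^{*k}/k!$ with $\delta^{*0}=\varepsilon$. *)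

theory Defs
  imports Complex_Main "HOL-Library.Poly_Mapping"
begin

section \<open>Free modules\<close>

text \<open>The free module with basis \<open>X\<close> is the set of finitely supported functions
  whose keys lie in \<open>X\<close>; the basis vector of \<open>S\<close> is \<open>basis S\<close>.\<close>

definition free_module :: "'s set \<Rightarrow> ('s \<Rightarrow>\<^sub>0 'k::zero) set"
  where "free_module X = {x. Poly_Mapping.keys x \<subseteq> X}"

abbreviation basis :: "'s \<Rightarrow> ('s \<Rightarrow>\<^sub>0 'k::zero_neq_one)"
  where "basis S \<equiv> Poly_Mapping.single S 1"

definition smul :: "'k::semiring_0 \<Rightarrow> ('s \<Rightarrow>\<^sub>0 'k) \<Rightarrow> ('s \<Rightarrow>\<^sub>0 'k)"
  where "smul c x = Poly_Mapping.map ((*) c) x"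

text \<open>Linear extension of a map given on basis elements, into a module with scalar
  multiplication \<open>scale\<close>.\<close>

definition lin_ext ::
    "('k::zero \<Rightarrow> 'v::comm_monoid_add \<Rightarrow> 'v) \<Rightarrow> ('s \<Rightarrow> 'v) \<Rightarrow> ('s \<Rightarrow>\<^sub>0 'k) \<Rightarrow> 'v"
  where "lin_ext scale f x = (\<Sum>S\<in>Poly_Mapping.keys x. scale (Poly_Mapping.lookup x S) (f S))"


section \<open>Minors systems\<close>

record ('s, 'e) minors_data =
  objs :: "'s set"
  elts :: "'s \<Rightarrow> 'e set"
  del :: "'s \<Rightarrow> 'e \<Rightarrow> 's"
  con :: "'s \<Rightarrow> 'e \<Rightarrow> 's"
  unit :: 's

text \<open>The grading is recovered from \<open>elts\<close>: an element of degree \<open>n\<close> is one whose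
  ground set has \<open>n\<close> elements.\<close>

definition objs_deg :: "('s, 'e, 'z) minors_data_scheme \<Rightarrow> nat \<Rightarrow> 's set"
  where "objs_deg M n = {S \<in> objs M. card (elts M S) = n}"

locale minors_system =
  fixes M :: "('s, 'e, 'z) minors_data_scheme"
  assumes finite_elts: "S \<in> objs M \<Longrightarrow> finite (elts M S)"
    and objs_deg_0: "objs_deg M 0 = {unit M}"
    and del_closed: "S \<in> objs M \<Longrightarrow> e \<in> elts M S \<Longrightarrow> del M S e \<in> objs M"
    and con_closed: "S \<in> objs M \<Longrightarrow> e \<in> elts M S \<Longrightarrow> con M S e \<in> objs M"
    and elts_del: "S \<in> objs M \<Longrightarrow> e \<in> elts M S \<Longrightarrow> elts M (del M S e) = elts M S - {e}"
    and elts_con: "S \<in> objs M \<Longrightarrow> e \<in> elts M S \<Longrightarrow> elts M (con M S e) = elts M S - {e}"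
    and del_del: "S \<in> objs M \<Longrightarrow> e \<in> elts M S \<Longrightarrow> f \<in> elts M S \<Longrightarrow> e \<noteq> f \<Longrightarrow>
      del M (del M S e) f = del M (del M S f) e"
    and con_con: "S \<in> objs M \<Longrightarrow> e \<in> elts M S \<Longrightarrow> f \<in> elts M S \<Longrightarrow> e \<noteq> f \<Longrightarrow>
      con M (con M S e) f = con M (con M S f) e"
    and del_con: "S \<in> objs M \<Longrightarrow> e \<in> elts M S \<Longrightarrow> f \<in> elts M S \<Longrightarrow> e \<noteq> f \<Longrightarrow>
      con M (del M S e) f = del M (con M S f) e"

text \<open>Deletion and contraction of a set \<open>A \<subseteq> elts M S\<close>; the order in which the elements
  are removed is immaterial by the commutation axioms.\<close>

definition del_set :: "('s, 'e, 'z) minors_data_scheme \<Rightarrow> 's \<Rightarrow> 'e set \<Rightarrow> 's"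
  where "del_set M S A = Finite_Set.fold (\<lambda>e T. del M T e) S A"

definition con_set :: "('s, 'e, 'z) minors_data_scheme \<Rightarrow> 's \<Rightarrow> 'e set \<Rightarrow> 's"
  where "con_set M S A = Finite_Set.fold (\<lambda>e T. con M T e) S A"


section \<open>The Hopf algebra of a minors system\<close>

record (overloaded) ('s, 'e, 'k) hopf_data = "('s, 'e) minors_data" +
  prod :: "'s \<Rightarrow> 's \<Rightarrow> ('s \<Rightarrow>\<^sub>0 'k)"

definition hopf_space :: "('s, 'e, 'z) minors_data_scheme \<Rightarrow> ('s \<Rightarrow>\<^sub>0 'k::zero) set"
  where "hopf_space M = free_module (objs M)"

definition hopf_deg :: "('s, 'e, 'z) minors_data_scheme \<Rightarrow> nat \<Rightarrow> ('s \<Rightarrow>\<^sub>0 'k::zero) set"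
  where "hopf_deg M n = free_module (objs_deg M n)"

definition hopf_mult ::
    "('s, 'e, 'k::field_char_0) hopf_data \<Rightarrow> ('s \<Rightarrow>\<^sub>0 'k) \<Rightarrow> ('s \<Rightarrow>\<^sub>0 'k) \<Rightarrow> ('s \<Rightarrow>\<^sub>0 'k)"
  where "hopf_mult M x y = lin_ext smul (\<lambda>S. lin_ext smul (prod M S) y) x"

text \<open>Ground sets are actual sets, and the minor operations remove literally the named
  element. Hence \<open>elts (S T) = elts S \<squnion> elts T\<close> and the compatibility of the product with
  minors are imposed for elements \<open>S\<close>, \<open>T\<close> with disjoint ground sets, where the product is
  again a basis element; in general the product is only required to be additive in degree.
  Imposing them for overlapping ground sets would be contradictory: if
  \<open>elts S = {e}\<close> then \<open>S S\<close> would have two distinct elements \<open>x\<close>, \<open>y\<close>, and deleting either one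
  would give \<open>S\<close>, so that \<open>{y} = {e} = {x}\<close>.\<close>

locale minors_hopf = minors_system M
  for M :: "('s, 'e, 'k::field_char_0) hopf_data" +
  assumes prod_deg: "S \<in> objs_deg M m \<Longrightarrow> T \<in> objs_deg M n \<Longrightarrow> prod M S T \<in> hopf_deg M (m + n)"
    and prod_assoc: "S \<in> objs M \<Longrightarrow> T \<in> objs M \<Longrightarrow> U \<in> objs M \<Longrightarrow>
      hopf_mult M (prod M S T) (basis U) = hopf_mult M (basis S) (prod M T U)"
    and prod_unit_left: "S \<in> objs M \<Longrightarrow> prod M (unit M) S = basis S"
    and prod_unit_right: "S \<in> objs M \<Longrightarrow> prod M S (unit M) = basis S"
    and prod_minors: "S \<in> objs M \<Longrightarrow> T \<in> objs M \<Longrightarrow> elts M S \<inter> elts M T = {} \<Longrightarrow>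
      \<exists>P\<in>objs M. prod M S T = basis P \<and> elts M P = elts M S \<union> elts M T \<and>
        (\<forall>e\<in>elts M S. basis (del M P e) = prod M (del M S e) T \<and>
                       basis (con M P e) = prod M (con M S e) T) \<and>
        (\<forall>e\<in>elts M T. basis (del M P e) = prod M S (del M T e) \<and>
                       basis (con M P e) = prod M S (con M T e))"

text \<open>The tensor square of the free module on \<open>objs M\<close> is the free module on pairs.\<close>

definition coproduct ::
    "('s, 'e, 'z) minors_data_scheme \<Rightarrow> ('s \<Rightarrow>\<^sub>0 'k::field_char_0) \<Rightarrow> ('s \<times> 's \<Rightarrow>\<^sub>0 'k)"
  where "coproduct M = lin_ext smul
    (\<lambda>S. \<Sum>A\<in>Pow (elts M S). basis (del_set M S (elts M S - A), con_set M S A))"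


section \<open>Combinatorial duality\<close>

text \<open>An algebra endomorphism \<open>S \<mapsto> S\<^sup>*\<close> of the Hopf algebra that takes elements of the minors
  system to elements of the minors system, as is needed for \<open>S\<^sup>*//e\<close> to make sense; for the
  same reason \<open>e\<close> has to belong to the ground set of \<open>S\<^sup>*\<close>.\<close>

locale combinatorial_duality = minors_hopf M
  for M :: "('s, 'e, 'k::field_char_0) hopf_data" +
  fixes star :: "('s \<Rightarrow>\<^sub>0 'k) \<Rightarrow> ('s \<Rightarrow>\<^sub>0 'k)"
  assumes star_add: "x \<in> hopf_space M \<Longrightarrow> y \<in> hopf_space M \<Longrightarrow> star (x + y) = star x + star y"
    and star_smul: "x \<in> hopf_space M \<Longrightarrow> star (smul c x) = smul c (star x)"
    and star_mult: "x \<in> hopf_space M \<Longrightarrow> y \<in> hopf_space M \<Longrightarrow>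
      star (hopf_mult M x y) = hopf_mult M (star x) (star y)"
    and star_unit: "star (basis (unit M)) = basis (unit M)"
    and star_deg: "x \<in> hopf_deg M n \<Longrightarrow> star x \<in> hopf_deg M n"
    and star_star: "x \<in> hopf_space M \<Longrightarrow> star (star x) = x"
    and star_minors: "S \<in> objs M \<Longrightarrow>
      \<exists>T\<in>objs M. star (basis S) = basis T \<and>
        (\<forall>e\<in>elts M S. e \<in> elts M T \<and>
          star (basis (del M S e)) = basis (con M T e) \<and>
          star (basis (con M S e)) = basis (del M T e))"


section \<open>Convolution and selectors\<close>

text \<open>The coefficients \<open>a\<^sub>i\<close>, \<open>b\<^sub>i\<close>, and hence the values of all linear forms, lie in
  a commutative algebra over the ground field, such as the field itself or a polynomial
  ring in indeterminates \<open>a\<^sub>i\<close>, \<open>b\<^sub>i\<close>.\<close>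

locale comm_algebra = vector_space scale
  for scale :: "'k::field_char_0 \<Rightarrow> 'r::comm_ring_1 \<Rightarrow> 'r" +
  assumes scale_mult: "scale c (x * y) = scale c x * y"

definition counit ::
    "('k \<Rightarrow> 'r \<Rightarrow> 'r) \<Rightarrow> ('s, 'e, 'z) minors_data_scheme \<Rightarrow>
      ('s \<Rightarrow>\<^sub>0 'k::field_char_0) \<Rightarrow> 'r::comm_ring_1"
  where "counit scale M = lin_ext scale (\<lambda>S. if S \<in> objs_deg M 0 then 1 else 0)"

definition conv ::
    "('k \<Rightarrow> 'r \<Rightarrow> 'r) \<Rightarrow> ('s, 'e, 'z) minors_data_scheme \<Rightarrow> (('s \<Rightarrow>\<^sub>0 'k) \<Rightarrow> 'r) \<Rightarrow>
      (('s \<Rightarrow>\<^sub>0 'k) \<Rightarrow> 'r) \<Rightarrow> ('s \<Rightarrow>\<^sub>0 'k::field_char_0) \<Rightarrow> 'r::comm_ring_1"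
  where "conv scale M f g x =
    lin_ext scale (\<lambda>(S, T). f (basis S) * g (basis T)) (coproduct M x)"

primrec conv_pow ::
    "('k \<Rightarrow> 'r \<Rightarrow> 'r) \<Rightarrow> ('s, 'e, 'z) minors_data_scheme \<Rightarrow> (('s \<Rightarrow>\<^sub>0 'k) \<Rightarrow> 'r) \<Rightarrow>
      nat \<Rightarrow> ('s \<Rightarrow>\<^sub>0 'k::field_char_0) \<Rightarrow> 'r::comm_ring_1"
  where
    "conv_pow scale M d 0 = counit scale M"
  | "conv_pow scale M d (Suc k) = conv scale M d (conv_pow scale M d k)"

text \<open>The exponential series is evaluated pointwise as the finite sum of its nonzero terms:
  if \<open>d\<close> is linear and vanishes on basis elements of degree other than 1, its \<open>k\<close>-th convolution
  power vanishes on basis elements of degree other than \<open>k\<close>.\<close>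

definition conv_exp ::
    "('k \<Rightarrow> 'r \<Rightarrow> 'r) \<Rightarrow> ('s, 'e, 'z) minors_data_scheme \<Rightarrow> (('s \<Rightarrow>\<^sub>0 'k) \<Rightarrow> 'r) \<Rightarrow>
      ('s \<Rightarrow>\<^sub>0 'k::field_char_0) \<Rightarrow> 'r::comm_ring_1"
  where "conv_exp scale M d x =
    (\<Sum>k | conv_pow scale M d k x \<noteq> 0. scale (1 / fact k) (conv_pow scale M d k x))"

definition delta ::
    "('k \<Rightarrow> 'r \<Rightarrow> 'r) \<Rightarrow> 's \<Rightarrow> ('s \<Rightarrow>\<^sub>0 'k::field_char_0) \<Rightarrow> 'r::comm_ring_1"
  where "delta scale T = lin_ext scale (\<lambda>S. if S = T then 1 else 0)"

text \<open>\<open>\<Sum>\<^sub>i a\<^sub>i \<delta>\<^sub>i\<close> for a family \<open>(obj i)\<close>, \<open>i \<in> I\<close>, enumerating the elements of degree 1.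
  The index set may be infinite, but only finitely many \<open>\<delta>\<^sub>i\<close> are nonzero at a given vector.\<close>

definition selector ::
    "('k \<Rightarrow> 'r \<Rightarrow> 'r) \<Rightarrow> 'i set \<Rightarrow> ('i \<Rightarrow> 's) \<Rightarrow> ('i \<Rightarrow> 'r) \<Rightarrow>
      ('s \<Rightarrow>\<^sub>0 'k::field_char_0) \<Rightarrow> 'r::comm_ring_1"
  where "selector scale I obj a x =
    (\<Sum>i | i \<in> I \<and> delta scale (obj i) x \<noteq> 0. a i * delta scale (obj i) x)"

definition alpha ::
    "('k \<Rightarrow> 'r \<Rightarrow> 'r) \<Rightarrow> ('s, 'e, 'z) minors_data_scheme \<Rightarrow> (('s \<Rightarrow>\<^sub>0 'k) \<Rightarrow> 'r) \<Rightarrow>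
      (('s \<Rightarrow>\<^sub>0 'k) \<Rightarrow> 'r) \<Rightarrow> ('s \<Rightarrow>\<^sub>0 'k::field_char_0) \<Rightarrow> 'r::comm_ring_1"
  where "alpha scale M d d' = conv scale M (conv_exp scale M d) (conv_exp scale M d')"

end

(*
  On basis elements the duality D exchanges restriction and contraction, hence reverses the order
  of convolution: writing f' for the composite of f with D, the convolution of f' and g' is that of
  g and f, composed with D. Convolution is associative and the counit is neutral on basis elements,
  so a form commutes with its convolution powers and exp(d') is exp(d) composed with D. Both sides
  of the identity are linear in x, so basis elements suffice.
*)
theory Submission imports Defs begin

section \<open>Linear extension\<close>

text \<open>Sums and multiples can lose keys. Expanding over one larger finite set lets both sides
  of an identity be compared term by term, the extra terms being zero.\<close>

lemma lin_ext_superset: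
  assumes "module scale" "finite A" "Poly_Mapping.keys x \<subseteq> A"
  shows "lin_ext scale f x = (\<Sum>S\<in>A. scale (Poly_Mapping.lookup x S) (f S))"
proof -
  interpret module scale by fact
  show ?thesis
    unfolding lin_ext_def using assms
    by (intro sum.mono_neutral_left) (auto simp: in_keys_iff)
qed

lemma lin_ext_add:
  assumes "module scale"
  shows "lin_ext scale f (x + y) = lin_ext scale f x + lin_ext scale f y"
proof -
  interpret module scale by fact
  let ?A = "Poly_Mapping.keys x \<union> Poly_Mapping.keys y"
  have "Poly_Mapping.keys (x + y) \<subseteq> ?A" by (rule Poly_Mapping.keys_add)
  then show ?thesis
    using assms by (simp add: lin_ext_superset[of scale ?A] lookup_add scale_left_distrib sum.distrib)
qed

lemma lin_ext_zero: "lin_ext scale f 0 = 0"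
  by (simp add: lin_ext_def)

lemma lin_ext_sum:
  assumes "module scale"
  shows "lin_ext scale f (\<Sum>i\<in>A. g i) = (\<Sum>i\<in>A. lin_ext scale f (g i))"
  by (induction A rule: infinite_finite_induct) (auto simp: lin_ext_add[OF assms] lin_ext_zero)

lemma lookup_smul: "Poly_Mapping.lookup (smul c x) S = c * Poly_Mapping.lookup x S"
  by (simp add: smul_def map.rep_eq when_def)

lemma lin_ext_smul:
  assumes "module scale"
  shows "lin_ext scale f (smul c x) = scale c (lin_ext scale f x)"
proof -
  interpret module scale by fact
  have "Poly_Mapping.keys (smul c x) \<subseteq> Poly_Mapping.keys x"
    by (auto simp: in_keys_iff lookup_smul)
  then show ?thesis
    using assms
    by (simp add: lin_ext_superset[of scale "Poly_Mapping.keys x"] lookup_smul scale_sum_right)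
qed

lemma lin_ext_basis:
  fixes scale :: "'k::comm_ring_1 \<Rightarrow> 'v::ab_group_add \<Rightarrow> 'v"
  assumes "module scale"
  shows "lin_ext scale f (basis S) = f S"
proof -
  interpret module scale by fact
  show ?thesis by (simp add: lin_ext_def)
qed

text \<open>Makes the \<open>lin_ext\<close> lemmas applicable to the coproduct, whose values are
  finitely supported functions on pairs.\<close>

lemma module_smul: "module (smul :: 'k::comm_ring_1 \<Rightarrow> ('s \<Rightarrow>\<^sub>0 'k) \<Rightarrow> _)"
  by unfold_locales (auto intro!: poly_mapping_eqI simp: lookup_smul lookup_add algebra_simps)

lemma smul_basis: "smul c (basis S) = Poly_Mapping.single S (c :: 'k::comm_ring_1)"
  by (auto intro!: poly_mapping_eqI simp: lookup_smul lookup_single when_def)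

text \<open>Turns equations between basis vectors, as supplied by \<open>star\<close>, into
  equations between elements of the minors system.\<close>

lemma basis_inject: "(basis S :: 's \<Rightarrow>\<^sub>0 'k::zero_neq_one) = basis T \<longleftrightarrow> S = T"
  by (metis lookup_single_eq lookup_single_not_eq zero_neq_one)

lemma free_module_induct [consumes 1, case_names zero add]:
  fixes x :: "'s \<Rightarrow>\<^sub>0 'k::comm_ring_1"
  assumes "x \<in> free_module X"
    and zero: "P 0"
    and add: "\<And>S c y. S \<in> X \<Longrightarrow> y \<in> free_module X \<Longrightarrow> P y \<Longrightarrow> P (smul c (basis S) + y)"
  shows "P x"
  using assms(1)
proof (induction x rule: update_induct)
  case const
  show ?case by (rule zero)
next
  case (update y S c)
  \<comment> \<open>As \<open>S\<close> is not yet a key of \<open>y\<close>, overwriting its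
    coefficient amounts to adding a multiple of its basis vector.\<close>
  have eq: "Poly_Mapping.update S c y = smul c (basis S) + y"
    using update.hyps
    by (auto intro!: poly_mapping_eqI
        simp: smul_basis lookup_update lookup_add lookup_single when_def in_keys_iff)
  have "Poly_Mapping.keys (Poly_Mapping.update S c y) = insert S (Poly_Mapping.keys y)"
    using update.hyps by (auto simp: in_keys_iff lookup_update split: if_splits)
  then have "S \<in> X" "y \<in> free_module X"
    using update.prems by (auto simp: free_module_def)
  then show ?case
    unfolding eq using update.IH by (intro add) auto
qed

section \<open>Iterated minors\<close>

text \<open>The operation \<open>r\<close> is controlled only on \<open>X\<close> and for elements of the current ground set,
  so it need not satisfy the hypotheses of the library's fold lemmas; its extension by the
  identity does.\<close>

locale removal =
  fixes X :: "'s set" and E :: "'s \<Rightarrow> 'e set" and r :: "'s \<Rightarrow> 'e \<Rightarrow> 's"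
  assumes closed: "S \<in> X \<Longrightarrow> e \<in> E S \<Longrightarrow> r S e \<in> X"
    and ground: "S \<in> X \<Longrightarrow> e \<in> E S \<Longrightarrow> E (r S e) = E S - {e}"
    and commute: "S \<in> X \<Longrightarrow> e \<in> E S \<Longrightarrow> f \<in> E S \<Longrightarrow> e \<noteq> f \<Longrightarrow> r (r S e) f = r (r S f) e"
begin

definition total :: "'e \<Rightarrow> 's \<Rightarrow> 's"
  where "total e S = (if S \<in> X \<and> e \<in> E S then r S e else S)"

sublocale total: comp_fun_commute total
proof
  fix e f show "total f \<circ> total e = total e \<circ> total f"
    \<comment> \<open>For distinct \<open>e\<close> and \<open>f\<close>, removing one does not
      affect whether the other lies in the ground set, so both orders pass the same guards.\<close>
    by (cases "e = f") (auto simp: total_def fun_eq_iff closed ground commute)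
qed

lemma fold_total:
  assumes "finite A" "S \<in> X" "A \<subseteq> E S"
  shows "Finite_Set.fold total S A \<in> X \<and> E (Finite_Set.fold total S A) = E S - A"
  using assms by (induction A rule: finite_induct) (auto simp: total_def closed ground)

text \<open>Every intermediate object still contains the element to be removed next, so the guard in
  \<open>total\<close> is always met. The comparison is made on \<open>fold_graph\<close>, which
  underlies \<open>Finite_Set.fold\<close>, because commutation of \<open>r\<close> itself is known
  only under guards.\<close>

lemma fold_graph_total_iff:
  assumes "S \<in> X" "finite A" "A \<subseteq> E S"
  shows "fold_graph (\<lambda>e T. r T e) S A T \<longleftrightarrow> fold_graph total S A T"
proof
  assume "fold_graph (\<lambda>e T. r T e) S A T"
  then show "fold_graph total S A T"
    using assms(2,3)
  proof induction
    case emptyI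
    show ?case by (rule fold_graph.emptyI)
  next
    case (insertI x A T)
    then have g: "fold_graph total S A T" by simp
    \<comment> \<open>Uniqueness of the fold of \<open>total\<close> identifies the intermediate
      \<open>T\<close>, so that \<open>fold_total\<close> describes it.\<close>
    have "Finite_Set.fold total S A = T"
      using g by (rule total.fold_equality)
    then have "r T x = total x T"
      using fold_total[of A S] insertI assms(1) by (auto simp: total_def)
    then show ?case
      using g insertI by (auto intro: fold_graph.insertI)
  qed
next
  assume "fold_graph total S A T"
  then show "fold_graph (\<lambda>e T. r T e) S A T"
    using assms(2,3)
  proof induction
    case emptyI
    show ?case by (rule fold_graph.emptyI)
  next
    case (insertI x A T)
    have "Finite_Set.fold total S A = T"
      using insertI by (intro total.fold_equality)
    then have "r T x = total x T"
      using fold_total[of A S] insertI assms(1) by (auto simp: total_def)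
    moreover have "fold_graph (\<lambda>e T. r T e) S (insert x A) (r T x)"
      using insertI by (auto intro: fold_graph.insertI)
    ultimately show ?case by simp
  qed
qed

lemma fold_eq_total:
  assumes "S \<in> X" "A \<subseteq> E S"
  shows "Finite_Set.fold (\<lambda>e T. r T e) S A = Finite_Set.fold total S A"
proof (cases "finite A")
  case True
  then have "fold_graph (\<lambda>e T. r T e) S A = fold_graph total S A"
    using fold_graph_total_iff assms by (intro ext) auto
  then show ?thesis by (simp add: Finite_Set.fold_def)
\<comment> \<open>For infinite \<open>A\<close> both folds return \<open>S\<close> by
  convention.\<close>
qed simp

lemma fold_closed:
  assumes "finite A" "S \<in> X" "A \<subseteq> E S"
  shows "Finite_Set.fold (\<lambda>e T. r T e) S A \<in> X"
    and "E (Finite_Set.fold (\<lambda>e T. r T e) S A) = E S - A"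
  using fold_total[OF assms] assms by (auto simp: fold_eq_total)

lemma fold_insert:
  assumes "finite A" "S \<in> X" "insert e A \<subseteq> E S" "e \<notin> A"
  shows "Finite_Set.fold (\<lambda>e T. r T e) S (insert e A) = r (Finite_Set.fold (\<lambda>e T. r T e) S A) e"
  using assms fold_total[of A S] by (simp add: fold_eq_total total_def)

end

section \<open>Deletion and contraction of subsets of the ground set\<close>

context minors_system
begin

sublocale del: removal "objs M" "elts M" "del M"
  by unfold_locales (auto simp: del_closed elts_del intro: del_del)

sublocale con: removal "objs M" "elts M" "con M"
  by unfold_locales (auto simp: con_closed elts_con intro: con_con)

lemma del_set_empty [simp]: "del_set M S {} = S"
  and con_set_empty [simp]: "con_set M S {} = S"
  by (simp_all add: del_set_def con_set_def)

lemma finite_subset_elts: "S \<in> objs M \<Longrightarrow> A \<subseteq> elts M S \<Longrightarrow> finite A"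
  using finite_elts finite_subset by blast

lemma minor_set_closed:
  assumes "S \<in> objs M" "A \<subseteq> elts M S"
  shows "del_set M S A \<in> objs M" "elts M (del_set M S A) = elts M S - A"
    and "con_set M S A \<in> objs M" "elts M (con_set M S A) = elts M S - A"
  unfolding del_set_def con_set_def
  using assms finite_subset_elts[OF assms] by (auto simp: del.fold_closed con.fold_closed)

lemma minor_set_insert:
  assumes "S \<in> objs M" "insert e A \<subseteq> elts M S" "e \<notin> A"
  shows "del_set M S (insert e A) = del M (del_set M S A) e"
    and "con_set M S (insert e A) = con M (con_set M S A) e"
proof -
  have "finite A" using finite_subset_elts[OF assms(1,2)] by simp
  then show "del_set M S (insert e A) = del M (del_set M S A) e"
    and "con_set M S (insert e A) = con M (con_set M S A) e"
    unfolding del_set_def con_set_def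
    using assms by (auto simp: del.fold_insert con.fold_insert)
qed

lemma minor_set_Un:
  assumes "S \<in> objs M" "A \<subseteq> elts M S" "B \<subseteq> elts M S" "A \<inter> B = {}"
  shows "del_set M (del_set M S A) B = del_set M S (A \<union> B) \<and>
    con_set M (con_set M S A) B = con_set M S (A \<union> B)"
proof -
  have "finite B" using assms finite_subset_elts by blast
  then show ?thesis
    using assms(3,4)
  proof induction
    case empty
    then show ?case by simp
  next
    case (insert x B)
    have "A \<union> insert x B = insert x (A \<union> B)" by simp
    moreover have "x \<in> elts M S - A" "B \<subseteq> elts M S - A"
      using insert by auto
    ultimately show ?case
      using insert assms by (simp add: minor_set_closed minor_set_insert)
  qed
qed

lemma del_con_set:
  assumes "S \<in> objs M" "e \<in> elts M S" "A \<subseteq> elts M S" "e \<notin> A"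
  shows "del M (con_set M S A) e = con_set M (del M S e) A"
proof -
  have "finite A" using assms finite_subset_elts by blast
  then show ?thesis
    using assms(3,4)
  proof induction
    case empty
    then show ?case by simp
  next
    case (insert x A)
    have "del M (con_set M S (insert x A)) e = del M (con M (con_set M S A) x) e"
      using insert assms by (simp add: minor_set_insert)
    \<comment> \<open>The axiom \<open>del_con\<close> is applied to \<open>con_set M S A\<close>,
      whose ground set still contains both \<open>e\<close> and \<open>x\<close>.\<close>
    also have "\<dots> = con M (del M (con_set M S A) e) x"
      using insert assms by (intro del_con[symmetric]) (auto simp: minor_set_closed)
    also have "\<dots> = con M (con_set M (del M S e) A) x"
      using insert assms by simp
    also have "\<dots> = con_set M (del M S e) (insert x A)"
      using insert assms
      by (intro minor_set_insert(2)[symmetric]) (auto simp: del_closed elts_del)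
    finally show ?case .
  qed
qed

lemma del_set_con_set:
  assumes "S \<in> objs M" "A \<subseteq> elts M S" "B \<subseteq> elts M S" "A \<inter> B = {}"
  shows "del_set M (con_set M S A) B = con_set M (del_set M S B) A"
proof -
  have "finite B" using assms finite_subset_elts by blast
  then show ?thesis
    using assms(3,4)
  proof induction
    case empty
    then show ?case by simp
  next
    case (insert x B)
    have "del_set M (con_set M S A) (insert x B) = del M (del_set M (con_set M S A) B) x"
      using insert assms by (intro minor_set_insert(1)) (auto simp: minor_set_closed)
    also have "\<dots> = del M (con_set M (del_set M S B) A) x"
      using insert assms by simp
    also have "\<dots> = con_set M (del M (del_set M S B) x) A"
      using insert assms by (intro del_con_set) (auto simp: minor_set_closed)
    also have "\<dots> = con_set M (del_set M S (insert x B)) A"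
      using insert assms by (simp add: minor_set_insert)
    finally show ?case .
  qed
qed

end

section \<open>Convolution\<close>

text \<open>Chains B \<subseteq> A \<subseteq> E and disjoint pairs B, C in E both encode the
  splittings of E into three blocks, via C = A - B.\<close>

lemma sum_Pow_Pow:
  fixes F :: "'a set \<Rightarrow> 'a set \<Rightarrow> 'b::comm_monoid_add"
  assumes "finite E"
  shows "(\<Sum>A\<in>Pow E. \<Sum>B\<in>Pow A. F A B) = (\<Sum>B\<in>Pow E. \<Sum>C\<in>Pow (E - B). F (B \<union> C) B)"
proof -
  have "(\<Sum>A\<in>Pow E. \<Sum>B\<in>Pow A. F A B) = (\<Sum>(A, B)\<in>(SIGMA A:Pow E. Pow A). F A B)"
    using assms by (intro sum.Sigma) (auto intro: finite_subset)
  also have "\<dots> = (\<Sum>(B, C)\<in>(SIGMA B:Pow E. Pow (E - B)). F (B \<union> C) B)"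
    by (rule sum.reindex_bij_witness[where i = "\<lambda>(B, C). (B \<union> C, B)" and j = "\<lambda>(A, B). (B, A - B)"])
      (auto simp: Un_absorb1)
  also have "\<dots> = (\<Sum>B\<in>Pow E. \<Sum>C\<in>Pow (E - B). F (B \<union> C) B)"
    using assms by (intro sum.Sigma[symmetric]) auto
  finally show ?thesis .
qed

section \<open>Convolution of forms on a minors system\<close>

locale minors_conv = minors_system M + comm_algebra scale
  for M :: "('s, 'e, 'z) minors_data_scheme"
    and scale :: "'k::field_char_0 \<Rightarrow> 'r::comm_ring_1 \<Rightarrow> 'r"
begin

lemma conv_add: "conv scale M f g (x + y) = conv scale M f g x + conv scale M f g y"
  by (simp add: conv_def coproduct_def lin_ext_add module_axioms module_smul)

lemma conv_smul: "conv scale M f g (smul c x) = scale c (conv scale M f g x)"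
  by (simp add: conv_def coproduct_def lin_ext_smul module_axioms module_smul)

lemma conv_zero: "conv scale M f g 0 = 0"
  by (simp add: conv_def coproduct_def lin_ext_zero)

lemma conv_basis:
  "conv scale M f g (basis S) =
    (\<Sum>A\<in>Pow (elts M S). f (basis (del_set M S (elts M S - A))) * g (basis (con_set M S A)))"
  by (simp add: conv_def coproduct_def lin_ext_basis lin_ext_sum module_axioms module_smul)

lemma counit_basis: "S \<in> objs M \<Longrightarrow> counit scale M (basis S) = (if elts M S = {} then 1 else 0)"
  using finite_elts by (auto simp: counit_def lin_ext_basis module_axioms objs_deg_def)

text \<open>Convolution consults its arguments on basis elements only, so identities of forms known
  only there may be substituted inside it.\<close>

lemma conv_cong:
  assumes "S \<in> objs M"
    and "\<And>T. T \<in> objs M \<Longrightarrow> f (basis T) = f' (basis T)"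
    and "\<And>T. T \<in> objs M \<Longrightarrow> g (basis T) = g' (basis T)"
  shows "conv scale M f g (basis S) = conv scale M f' g' (basis S)"
  unfolding conv_basis using assms by (intro sum.cong) (auto simp: minor_set_closed)

text \<open>Exactly one subset survives: the counit wants an empty ground set, which forces A to be
  the whole ground set when the counit is the right factor, and empty when it is the left
  one.\<close>

lemma conv_counit:
  assumes "S \<in> objs M"
  shows "conv scale M f (counit scale M) (basis S) = f (basis S)"
    and "conv scale M (counit scale M) f (basis S) = f (basis S)"
proof -
  have "conv scale M f (counit scale M) (basis S) =
      (\<Sum>A\<in>Pow (elts M S). if A = elts M S then f (basis S) else 0)"
    unfolding conv_basis using assms
    by (intro sum.cong) (auto simp: counit_basis minor_set_closed)
  then show "conv scale M f (counit scale M) (basis S) = f (basis S)"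
    using assms finite_elts by simp
  have "conv scale M (counit scale M) f (basis S) =
      (\<Sum>A\<in>Pow (elts M S). if A = {} then f (basis S) else 0)"
    unfolding conv_basis using assms
    by (intro sum.cong) (auto simp: counit_basis minor_set_closed)
  then show "conv scale M (counit scale M) f (basis S) = f (basis S)"
    using assms finite_elts by simp
qed

text \<open>Coassociativity: both sides sum over splittings of the ground set into B, A - B and the
  complement of A. Here \<open>f\<close> receives the restriction to B, \<open>h\<close> the
  contraction by A, and \<open>g\<close> the minor on A - B.\<close>

lemma conv_assoc:
  assumes S: "S \<in> objs M"
  shows "conv scale M (conv scale M f g) h (basis S) = conv scale M f (conv scale M g h) (basis S)"
proof -
  let ?E = "elts M S"
  let ?F = "\<lambda>A B. f (basis (del_set M S (?E - B))) *
    g (basis (con_set M (del_set M S (?E - A)) B)) * h (basis (con_set M S A))"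
  have "conv scale M (conv scale M f g) h (basis S) = (\<Sum>A\<in>Pow ?E. \<Sum>B\<in>Pow A. ?F A B)"
    unfolding conv_basis
  proof (rule sum.cong[OF refl])
    fix A assume A: "A \<in> Pow ?E"
    then have E: "elts M (del_set M S (?E - A)) = A"
      using S by (auto simp: minor_set_closed)
    have "del_set M (del_set M S (?E - A)) (A - B) = del_set M S (?E - B)" if "B \<subseteq> A" for B
    proof -
      have "del_set M (del_set M S (?E - A)) (A - B) = del_set M S ((?E - A) \<union> (A - B))"
        using S A by (intro minor_set_Un[THEN conjunct1]) auto
      also have "(?E - A) \<union> (A - B) = ?E - B"
        using A that by auto
      finally show ?thesis .
    qed
    then show "(\<Sum>B\<in>Pow (elts M (del_set M S (?E - A))).
        f (basis (del_set M (del_set M S (?E - A)) (elts M (del_set M S (?E - A)) - B))) *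
        g (basis (con_set M (del_set M S (?E - A)) B))) * h (basis (con_set M S A)) =
        (\<Sum>B\<in>Pow A. ?F A B)"
      unfolding E sum_distrib_right by (intro sum.cong) auto
  qed
  also have "\<dots> = (\<Sum>B\<in>Pow ?E. \<Sum>C\<in>Pow (?E - B). ?F (B \<union> C) B)"
    using S finite_elts by (intro sum_Pow_Pow)
  also have "\<dots> = conv scale M f (conv scale M g h) (basis S)"
    unfolding conv_basis
  proof (rule sum.cong[OF refl])
    fix B assume B: "B \<in> Pow ?E"
    then have E: "elts M (con_set M S B) = ?E - B"
      using S by (auto simp: minor_set_closed)
    have "con_set M (con_set M S B) C = con_set M S (B \<union> C)" if "C \<subseteq> ?E - B" for C
      using S B that by (intro minor_set_Un[THEN conjunct2]) auto
    \<comment> \<open>The two sides build the middle minor in opposite orders; disjointness of the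
      contracted and the deleted set lets them agree.\<close>
    moreover have "del_set M (con_set M S B) (?E - B - C) = con_set M (del_set M S (?E - (B \<union> C))) B"
      if "C \<subseteq> ?E - B" for C
    proof -
      have "?E - B - C = ?E - (B \<union> C)" by auto
      then show ?thesis using S B by (auto intro!: del_set_con_set)
    qed
    ultimately show "(\<Sum>C\<in>Pow (?E - B). ?F (B \<union> C) B) = f (basis (del_set M S (?E - B))) *
        (\<Sum>C\<in>Pow (elts M (con_set M S B)).
          g (basis (del_set M (con_set M S B) (elts M (con_set M S B) - C))) *
          h (basis (con_set M (con_set M S B) C)))"
      unfolding E sum_distrib_left by (intro sum.cong) (auto simp: mult.assoc)
  qed
  finally show ?thesis .
qed

text \<open>Powers are defined by adding a factor on the left. The duality reverses factors, so the
  same recursion is needed on the right.\<close>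

lemma conv_pow_Suc_right:
  assumes "S \<in> objs M"
  shows "conv_pow scale M d (Suc k) (basis S) = conv scale M (conv_pow scale M d k) d (basis S)"
  using assms
proof (induction k arbitrary: S)
  case 0
  then show ?case by (simp add: conv_counit)
next
  case (Suc k)
  have "conv_pow scale M d (Suc (Suc k)) (basis S) =
      conv scale M d (conv scale M (conv_pow scale M d k) d) (basis S)"
    \<comment> \<open>Only the outer power is unfolded, so that the induction hypothesis can rewrite
      the inner one.\<close>
    unfolding conv_pow.simps(2)[of scale M d "Suc k"] using Suc by (intro conv_cong) auto
  also have "\<dots> = conv scale M (conv_pow scale M d (Suc k)) d (basis S)"
    using Suc.prems by (simp add: conv_assoc)
  finally show ?case .
qed

end

section \<open>Duality\<close>

context combinatorial_duality
begin

text \<open>\<open>star\<close> acts on vectors; this recovers its action on elements of the minors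
  system. The choice is forced by \<open>basis_inject\<close>.\<close>

definition dual :: "'s \<Rightarrow> 's"
  where "dual S = (SOME T. T \<in> objs M \<and> star (basis S) = basis T)"

lemma dual:
  assumes "S \<in> objs M"
  shows "dual S \<in> objs M" "star (basis S) = basis (dual S)"
  using star_minors[OF assms] someI_ex[of "\<lambda>T. T \<in> objs M \<and> star (basis S) = basis T"]
  unfolding dual_def by blast+

text \<open>The duality axiom yields only one inclusion. Preservation of degree makes the
  cardinalities equal, and the sets are finite.\<close>

lemma elts_dual:
  assumes "S \<in> objs M"
  shows "elts M (dual S) = elts M S"
proof -
  obtain T where T: "T \<in> objs M" "star (basis S) = basis T" "elts M S \<subseteq> elts M T"
    using star_minors[OF assms] by blast
  then have "elts M S \<subseteq> elts M (dual S)"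
    using dual[OF assms] by (simp add: basis_inject)
  moreover have "basis S \<in> (hopf_deg M (card (elts M S)) :: ('s \<Rightarrow>\<^sub>0 'k) set)"
    using assms by (simp add: hopf_deg_def free_module_def objs_deg_def)
  then have "basis (dual S) \<in> (hopf_deg M (card (elts M S)) :: ('s \<Rightarrow>\<^sub>0 'k) set)"
    using star_deg dual(2)[OF assms] by metis
  then have "card (elts M (dual S)) = card (elts M S)"
    by (simp add: hopf_deg_def free_module_def objs_deg_def)
  ultimately show ?thesis
    using card_subset_eq finite_elts[OF dual(1)[OF assms]] by metis
qed

lemma dual_dual:
  assumes "S \<in> objs M"
  shows "dual (dual S) = S"
proof -
  have "(basis S :: 's \<Rightarrow>\<^sub>0 'k) \<in> hopf_space M"
    using assms by (simp add: hopf_space_def free_module_def)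
  then have "star (star (basis S)) = basis S" by (rule star_star)
  then show ?thesis
    using assms by (simp add: dual basis_inject)
qed

lemma dual_minor:
  assumes "S \<in> objs M" "e \<in> elts M S"
  shows "dual (del M S e) = con M (dual S) e" "dual (con M S e) = del M (dual S) e"
  using star_minors[OF assms(1)] assms dual[OF assms(1)] dual(2)[of "del M S e"] dual(2)[of "con M S e"]
  by (auto simp: basis_inject del_closed con_closed)

lemma dual_minor_set:
  assumes "S \<in> objs M" "A \<subseteq> elts M S"
  shows "dual (del_set M S A) = con_set M (dual S) A \<and> dual (con_set M S A) = del_set M (dual S) A"
proof -
  have "finite A" using assms finite_subset_elts by blast
  then show ?thesis
    using assms(2)
    by induction
      (use assms(1) in \<open>auto simp: minor_set_insert minor_set_closed dual dual_minor elts_dual\<close>)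
qed

lemma star_zero: "star 0 = 0"
proof -
  have "(0 :: 's \<Rightarrow>\<^sub>0 'k) \<in> hopf_space M" by (simp add: hopf_space_def free_module_def)
  from star_add[OF this this] show ?thesis by simp
qed

end

section \<open>Convolution under the duality\<close>

locale duality_conv = combinatorial_duality M star + minors_conv M scale
  for M :: "('s, 'e, 'k::field_char_0) hopf_data" and star
    and scale :: "'k \<Rightarrow> 'r::comm_ring_1 \<Rightarrow> 'r"
begin

text \<open>The term of A matches the term of its complement: the dual of the restriction to A is
  the contraction of the dual by the complement of A. The factors trade places, which commutativity
  of the value ring absorbs.\<close>

lemma conv_dual:
  assumes S: "S \<in> objs M"
    and f: "\<And>T. T \<in> objs M \<Longrightarrow> f' (basis T) = f (basis (dual T))"
    and g: "\<And>T. T \<in> objs M \<Longrightarrow> g' (basis T) = g (basis (dual T))"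
  shows "conv scale M f' g' (basis S) = conv scale M g f (basis (dual S))"
  unfolding conv_basis elts_dual[OF S]
proof (rule sum.reindex_bij_witness[where i = "\<lambda>A. elts M S - A" and j = "\<lambda>A. elts M S - A"])
  fix A assume "A \<in> Pow (elts M S)"
  then have A: "A \<subseteq> elts M S" and AA: "elts M S - (elts M S - A) = A" by auto
  show "g (basis (del_set M (dual S) (elts M S - (elts M S - A)))) *
      f (basis (con_set M (dual S) (elts M S - A))) =
      f' (basis (del_set M S (elts M S - A))) * g' (basis (con_set M S A))"
    unfolding AA using S A by (simp add: f g minor_set_closed dual_minor_set mult.commute)
qed auto

lemma conv_pow_dual:
  assumes "S \<in> objs M"
  shows "conv_pow scale M (\<lambda>y. d (star y)) k (basis S) = conv_pow scale M d k (basis (dual S))"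
  using assms
proof (induction k arbitrary: S)
  case 0
  \<comment> \<open>The counit only tests whether the ground set is empty, and \<open>dual\<close>
    preserves it.\<close>
  then show ?case by (simp add: counit_basis dual elts_dual)
next
  case (Suc k)
  have "conv_pow scale M (\<lambda>y. d (star y)) (Suc k) (basis S) =
      conv scale M (conv_pow scale M d k) d (basis (dual S))"
    unfolding conv_pow.simps using Suc by (intro conv_dual) (auto simp: dual)
  also have "\<dots> = conv_pow scale M d (Suc k) (basis (dual S))"
    using Suc.prems by (intro conv_pow_Suc_right[symmetric] dual)
  finally show ?case .
qed

text \<open>All powers agree, hence so do the index sets of nonzero terms over which the two
  exponentials are summed.\<close>

lemma conv_exp_dual:
  "S \<in> objs M \<Longrightarrow> conv_exp scale M (\<lambda>y. d (star y)) (basis S) = conv_exp scale M d (basis (dual S))"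
  by (simp add: conv_exp_def conv_pow_dual)

lemma alpha_basis_dual:
  assumes "S \<in> objs M"
  shows "alpha scale M d d' (basis S) = alpha scale M (\<lambda>y. d' (star y)) (\<lambda>y. d (star y)) (basis (dual S))"
proof -
  \<comment> \<open>Reversal is applied at \<open>dual S\<close>, starting from the composed forms;
    \<open>dual_dual\<close> then returns to \<open>S\<close>.\<close>
  have "conv scale M (conv_exp scale M (\<lambda>y. d' (star y))) (conv_exp scale M (\<lambda>y. d (star y))) (basis (dual S)) =
      conv scale M (conv_exp scale M d) (conv_exp scale M d') (basis (dual (dual S)))"
    using assms by (intro conv_dual) (auto simp: dual conv_exp_dual)
  then show ?thesis
    using assms by (simp add: alpha_def dual_dual)
qed

lemma alpha_star:
  assumes "x \<in> hopf_space M"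
  shows "alpha scale M d d' x = alpha scale M (\<lambda>y. d' (star y)) (\<lambda>y. d (star y)) (star x)"
  using assms unfolding hopf_space_def
proof (induction x rule: free_module_induct)
  case zero
  show ?case by (simp add: star_zero alpha_def conv_zero)
next
  case (add S c y)
  \<comment> \<open>Linearity of \<open>star\<close> is available on \<open>hopf_space M\<close>
    only, so membership is checked for each summand.\<close>
  have S: "(basis S :: 's \<Rightarrow>\<^sub>0 'k) \<in> hopf_space M" "smul c (basis S) \<in> hopf_space M"
    using add by (auto simp: hopf_space_def free_module_def smul_basis)
  moreover have "y \<in> hopf_space M"
    using add by (simp add: hopf_space_def)
  ultimately have "star (smul c (basis S) + y) = smul c (basis (dual S)) + star y"
    using add by (simp only: star_add star_smul dual)
  then show ?case
    using add.IH alpha_basis_dual[OF add.hyps(1), of d d'] by (simp add: alpha_def conv_add conv_smul)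
qed

end

theorem theorem4p8:
  fixes scale :: "'k::field_char_0 \<Rightarrow> 'r::comm_ring_1 \<Rightarrow> 'r"
    and M :: "('s, 'e, 'k) hopf_data"
    and star :: "('s \<Rightarrow>\<^sub>0 'k) \<Rightarrow> ('s \<Rightarrow>\<^sub>0 'k)"
    and I :: "'i set" and obj :: "'i \<Rightarrow> 's"
    and a b :: "'i \<Rightarrow> 'r"
    and \<delta>\<^sub>a \<delta>\<^sub>b \<delta>\<^sub>a' \<delta>\<^sub>b' :: "('s \<Rightarrow>\<^sub>0 'k) \<Rightarrow> 'r"
  assumes "comm_algebra scale"
    and "minors_hopf M"
    and "combinatorial_duality M star"
    and "bij_betw obj I (objs_deg M 1)"
    and "\<delta>\<^sub>a = selector scale I obj a"
    and "\<delta>\<^sub>b = selector scale I obj b"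
    and "\<delta>\<^sub>a' = \<delta>\<^sub>a \<circ> star"
    and "\<delta>\<^sub>b' = \<delta>\<^sub>b \<circ> star"
  shows "\<forall>x\<in>hopf_space M. alpha scale M \<delta>\<^sub>a \<delta>\<^sub>b x = alpha scale M \<delta>\<^sub>b' \<delta>\<^sub>a' (star x)"
proof -
  interpret comm_algebra scale by fact
  interpret combinatorial_duality M star by fact
  interpret duality_conv M star scale by unfold_locales
  show ?thesis using assms(7,8) by (simp add: comp_def alpha_star)
qed

end
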